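(* For every complete structure $\mathcal S(\mathcal E,\mathcal V)$, the fd set $\Sigma := \mathsf{h\text{-}encode}(\mathcal S)$ is non-redundant. However, $\Sigma$ may fail to be canonical: there exists a complete structure $\mathcal S$ such that $\mathsf{h\text{-}encode}(\mathcal S)$ is not canonical.
   Context: **Functional dependencies.** Attributes are symbols; $XY$ denotes $X\cup Y$, and a single attribute is identified with its singleton set. A functional dependency (fd) on an attribute set $U$ is a pair $\langle X,Y\rangle$, also written $X\to Y$, with $X,Y\subseteq U$. For an fd set $\Sigma$, $\Sigma^+$ is the set of all fd's derivable from $\Sigma$ by Armstrong's rules: (R0) if $Y\subseteq X$ then $X\to Y$; (R1) if $X\to Y$ then $XZ\to YZ$; (R2) if $X\to Y$ and $Y\to W$ then $X\to W$. An fd set $\Sigma$ is *canonical* if (a) (singleton-rhs) every fd in $\Sigma$ has the form $X\to A$ with $|A|=1$; (b) (non-redundant) for no $\langle X,A\rangle\in\Sigma$ is $(\Sigma\setminus\{\langle X,A\rangle\})^+=\Sigma^+$; (c) (left-reduced) for each $X\to A$ in $\Sigma$ there is no $Y\subsetneq X$ with $(\Sigma\setminus\{X\to A\}\cup\{Y\to A\})^+=\Sigma^+$. **Structures.** A structure is a pair $\mathcal S(\mathcal E,\mathcal V)$, with $\mathcal E$ a finite set of equations over a finite set $\mathcal V$ of variables, $|\mathcal E|\le|\mathcal V|$, such that: (a) in any subset of $k$ equations at least $k$ different variables appear; (b) in any subset of $k$ equations in which $r\ge k$ variables appear, if the values of any $r-k$ of these variables are chosen arbitrarily, then the values of the remaining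 $k$ are determined uniquely. It is *complete* if $|\mathcal E|=|\mathcal V|$. It is *minimal* if it is complete and contains no complete structure $\mathcal S'\subsetneq\mathcal S$ (a substructure being a subset of the equations together with the variables appearing in them). The structure matrix $A_S$ of $\mathcal S$, with equations $f_1,\dots,f_n$ and variables $x_1,\dots,x_m$, has $A_S(i,j)=1$ if $x_j$ appears in $f_i$ and $0$ otherwise. **Procedure $\mathsf{COA}_t(\mathcal S)$** ($\mathcal S$ complete) returns a total causal mapping, i.e. a bijection $\varphi_t:\mathcal E\to\mathcal V$, as follows. For each minimal structure $\mathcal S'\subseteq\mathcal S$, map the equations of $\mathcal S'$ bijectively (arbitrarily) onto the variables of $\mathcal S'$. Then let $\mathcal T$ be obtained from $\mathcal S$ by removing the equations and eliminating the variables of all these minimal structures; if $\mathcal T\neq\varnothing$, recursively add the mapping $\mathsf{COA}_t(\mathcal T)$. **Procedure $\mathsf{h\text{-}encode}(\mathcal S)$** ($\mathcal S$ complete). Variables are identified with attributes, and $\phi,\upsilon$ are two further distinct attribute symbols not among the variables. Start with $\Sigma=\varnothing$ and $\varphi_t=\mathsf{COA}_t(\mathcal S)$. For each $\langle f_k,x_\ell\rangle\in\varphi_t$, let $Z=\{x_j: A_S(k,j)=1\}$; if $|Z|=1$ add the fd $\{\phi\}\to\{x_\ell\}$ to $\Sigma$, otherwise add the fd $(Z\setminus\{x_\ell\})\cup\{\upsilon\}\to\{x_\ell\}$. Return $\Sigma$. *)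

theory Defs
  imports Complex_Main "HOL-Library.FuncSet"
begin

section \<open>Functional dependencies\<close>

type_synonym 'a fd = "'a set \<times> 'a set"

inductive_set fd_closure :: "'a set \<Rightarrow> 'a fd set \<Rightarrow> 'a fd set"
  for U :: "'a set" and \<Sigma> :: "'a fd set"
where
  base: "d \<in> \<Sigma> \<Longrightarrow> d \<in> fd_closure U \<Sigma>"
| R0: "Y \<subseteq> X \<Longrightarrow> X \<subseteq> U \<Longrightarrow> (X, Y) \<in> fd_closure U \<Sigma>"
| R1: "(X, Y) \<in> fd_closure U \<Sigma> \<Longrightarrow> Z \<subseteq> U \<Longrightarrow> (X \<union> Z, Y \<union> Z) \<in> fd_closure U \<Sigma>"
| R2: "(X, Y) \<in> fd_closure U \<Sigma> \<Longrightarrow> (Y, W) \<in> fd_closure U \<Sigma> \<Longrightarrow> (X, W) \<in> fd_closure U \<Sigma>"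

definition singleton_rhs :: "'a fd set \<Rightarrow> bool" where
  "singleton_rhs \<Sigma> \<longleftrightarrow> (\<forall>(X, Y) \<in> \<Sigma>. card Y = 1)"

definition non_redundant :: "'a set \<Rightarrow> 'a fd set \<Rightarrow> bool" where
  "non_redundant U \<Sigma> \<longleftrightarrow>
     \<not> (\<exists>(X, A) \<in> \<Sigma>. fd_closure U (\<Sigma> - {(X, A)}) = fd_closure U \<Sigma>)"

definition left_reduced :: "'a set \<Rightarrow> 'a fd set \<Rightarrow> bool" where
  "left_reduced U \<Sigma> \<longleftrightarrow>
     (\<forall>(X, A) \<in> \<Sigma>. \<not> (\<exists>Y. Y \<subset> X \<and>
        fd_closure U ((\<Sigma> - {(X, A)}) \<union> {(Y, A)}) = fd_closure U \<Sigma>))"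

definition canonical :: "'a set \<Rightarrow> 'a fd set \<Rightarrow> bool" where
  "canonical U \<Sigma> \<longleftrightarrow> singleton_rhs \<Sigma> \<and> non_redundant U \<Sigma> \<and> left_reduced U \<Sigma>"


section \<open>Structures\<close>

text \<open>
  Equations are represented by labels of type \<open>'e\<close>, so that an equation keeps its identity
  when variables are eliminated from it. For each label, \<open>appears\<close> gives the variables
  appearing in the equation and \<open>holds\<close> says which assignments of values satisfy it.
\<close>

record ('e, 'v, 'd) eq_structure =
  eqs :: "'e set"
  vars :: "'v set"
  appears :: "'e \<Rightarrow> 'v set"
  holds :: "'e \<Rightarrow> ('v \<Rightarrow> 'd) \<Rightarrow> bool"

definition vars_of :: "('e, 'v, 'd) eq_structure \<Rightarrow> 'e set \<Rightarrow> 'v set" where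
  "vars_of S F = (\<Union>f\<in>F. appears S f)"

definition equations_over_vars :: "('e, 'v, 'd) eq_structure \<Rightarrow> bool" where
  "equations_over_vars S \<longleftrightarrow>
     (\<forall>f\<in>eqs S. appears S f \<subseteq> vars S \<and>
        (\<forall>\<sigma> \<tau>. (\<forall>x\<in>appears S f. \<sigma> x = \<tau> x) \<longrightarrow> holds S f \<sigma> = holds S f \<tau>))"

text \<open>
  In the last conjunct, \<open>C\<close> is the set of the variables whose values \<open>\<rho>\<close> are chosen.
  It ranges over all \<open>r - k\<close> element sets of appearing variables; the natural-number subtraction
  does not truncate because of the conjunct before it. Assignments to the appearing variables
  are normalised by \<^const>\<open>extensional\<close> so that uniqueness only concerns these variables.
\<close>

definition is_structure :: "('e, 'v, 'd) eq_structure \<Rightarrow> bool" where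
  "is_structure S \<longleftrightarrow>
     finite (eqs S) \<and> finite (vars S) \<and> card (eqs S) \<le> card (vars S) \<and>
     equations_over_vars S \<and>
     (\<forall>F. F \<subseteq> eqs S \<longrightarrow> card F \<le> card (vars_of S F)) \<and>
     (\<forall>F C. F \<subseteq> eqs S \<and> C \<subseteq> vars_of S F \<and> card C = card (vars_of S F) - card F \<longrightarrow>
        (\<forall>\<rho>. \<exists>!\<tau>. \<tau> \<in> extensional (vars_of S F) \<and>
               (\<forall>x\<in>C. \<tau> x = \<rho> x) \<and> (\<forall>f\<in>F. holds S f \<tau>)))"

definition complete_structure :: "('e, 'v, 'd) eq_structure \<Rightarrow> bool" where
  "complete_structure S \<longleftrightarrow> is_structure S \<and> card (eqs S) = card (vars S)"

definition substructure :: "('e, 'v, 'd) eq_structure \<Rightarrow> 'e set \<Rightarrow> ('e, 'v, 'd) eq_structure" where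
  "substructure S F = S\<lparr>eqs := F, vars := vars_of S F\<rparr>"

text \<open>
  The empty structure is complete, so minimality has to be understood among nonempty structures.
\<close>

definition minimal_structure :: "('e, 'v, 'd) eq_structure \<Rightarrow> bool" where
  "minimal_structure S \<longleftrightarrow> complete_structure S \<and> eqs S \<noteq> {} \<and>
     \<not> (\<exists>F. F \<noteq> {} \<and> F \<subset> eqs S \<and> complete_structure (substructure S F))"

definition structure_matrix :: "('e, 'v, 'd) eq_structure \<Rightarrow> 'e \<Rightarrow> 'v \<Rightarrow> nat" where
  "structure_matrix S f x = (if x \<in> appears S f then 1 else 0)"


section \<open>Total causal mappings\<close>

definition minimal_subs :: "('e, 'v, 'd) eq_structure \<Rightarrow> 'e set set" where
  "minimal_subs S = {F. F \<subseteq> eqs S \<and> minimal_structure (substructure S F)}"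

text \<open>
  Removing the equations \<open>F\<close> and eliminating their variables: in each remaining equation
  the variables of \<open>F\<close> are replaced by the values determined by \<open>F\<close>.
\<close>

definition eliminate :: "('e, 'v, 'd) eq_structure \<Rightarrow> 'e set \<Rightarrow> ('e, 'v, 'd) eq_structure" where
  "eliminate S F =
     \<lparr>eqs = eqs S - F,
      vars = vars S - vars_of S F,
      appears = (\<lambda>f. appears S f - vars_of S F),
      holds = (\<lambda>f \<sigma>. \<exists>\<tau>. (\<forall>x. x \<notin> vars_of S F \<longrightarrow> \<tau> x = \<sigma> x) \<and>
                         (\<forall>g\<in>F. holds S g \<tau>) \<and> holds S f \<tau>)\<rparr>"

text \<open>
  The procedure makes arbitrary choices \<open>g\<close>, so it is a relation between a structure and the
  graphs of the mappings it may return.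
\<close>

inductive coa_t :: "('e, 'v, 'd) eq_structure \<Rightarrow> ('e \<times> 'v) set \<Rightarrow> bool" where
  empty: "eqs S = {} \<Longrightarrow> coa_t S {}"
| step: "eqs S \<noteq> {} \<Longrightarrow>
    (\<And>F. F \<in> minimal_subs S \<Longrightarrow> bij_betw (g F) F (vars_of S F)) \<Longrightarrow>
    coa_t (eliminate S (\<Union>(minimal_subs S))) \<psi> \<Longrightarrow>
    coa_t S ({(f, g F f) | f F. F \<in> minimal_subs S \<and> f \<in> F} \<union> \<psi>)"


section \<open>Encoding a structure by functional dependencies\<close>

datatype 'v attr = Var 'v | Phi | Upsilon

definition attributes :: "('e, 'v, 'd) eq_structure \<Rightarrow> 'v attr set" where
  "attributes S = Var ` vars S \<union> {Phi, Upsilon}"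

definition encode_fd :: "('e, 'v, 'd) eq_structure \<Rightarrow> 'e \<Rightarrow> 'v \<Rightarrow> 'v attr fd" where
  "encode_fd S f x =
     (let Z = {y \<in> vars S. structure_matrix S f y = 1}
      in if card Z = 1 then ({Phi}, {Var x})
         else (Var ` (Z - {x}) \<union> {Upsilon}, {Var x}))"

text \<open>The set of all fd sets that the encoding procedure may return.\<close>

definition h_encode :: "('e, 'v, 'd) eq_structure \<Rightarrow> 'v attr fd set set" where
  "h_encode S = {{encode_fd S f x | f x. (f, x) \<in> \<phi>} | \<phi>. coa_t S \<phi>}"

end

theory Submission
  imports Defs
begin

text \<open>
  Call a set of equations tight if it has as many equations as variables. By condition (a) of a
  structure, \<open>F \<mapsto> |vars F| - |F|\<close> is nonnegative and submodular, so tight sets are closed under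
  union and intersection and distinct minimal structures share no variable. Hence a total causal
  mapping assigns each variable at most once, and every variable is the right-hand side of at most
  one encoded fd, whose left-hand side does not contain it. Without this fd the variable is not
  derivable.

  For the failure of canonicity, take two equations in \<open>x\<^sub>0, x\<^sub>1\<close> and a third one in
  \<open>x\<^sub>0, x\<^sub>1, x\<^sub>2\<close>. The first two make \<open>x\<^sub>1\<close> redundant on the left of \<open>x\<^sub>0 x\<^sub>1 \<upsilon> \<rightarrow> x\<^sub>2\<close>.
\<close>

section \<open>Functional dependencies\<close>

text \<open>Each of Armstrong's rules preserves "if \<open>a\<close> is on the right, it is on the
  left". This serves as a criterion for underivability.\<close>

lemma fd_closure_preserves:
  assumes "(X, Y) \<in> fd_closure U \<Sigma>" and "a \<in> Y"
    and "\<And>X Y. (X, Y) \<in> \<Sigma> \<Longrightarrow> a \<in> Y \<Longrightarrow> a \<in> X"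
  shows "a \<in> X"
proof -
  have "a \<in> Y \<longrightarrow> a \<in> X"
    using assms(1)
  proof (induction X Y rule: fd_closure.induct[split_format(complete)])
    case (base X Y)
    then show ?case using assms(3) by blast
  qed auto
  then show ?thesis using assms(2) by blast
qed

lemma fd_closure_subset:
  assumes "\<Sigma> \<subseteq> fd_closure U \<Sigma>'"
  shows "fd_closure U \<Sigma> \<subseteq> fd_closure U \<Sigma>'"
proof
  fix d assume "d \<in> fd_closure U \<Sigma>"
  then show "d \<in> fd_closure U \<Sigma>'"
    by induction (use assms in \<open>auto intro: fd_closure.intros\<close>)
qed

text \<open>Once \<open>(X, A)\<close> is removed, no remaining fd has \<open>a\<close> on the
  right, so \<open>a\<close> can only be derived from sets that already contain it. As
  \<open>a\<close> is not in \<open>X\<close>, the removed fd cannot be recovered.\<close>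

lemma non_redundantI:
  assumes "\<And>X A. (X, A) \<in> \<Sigma> \<Longrightarrow> \<exists>a\<in>A. a \<notin> X \<and> (\<forall>(Y, B)\<in>\<Sigma>. a \<in> B \<longrightarrow> (Y, B) = (X, A))"
  shows "non_redundant U \<Sigma>"
  unfolding non_redundant_def
proof safe
  fix X A assume XA: "(X, A) \<in> \<Sigma>" and eq: "fd_closure U (\<Sigma> - {(X, A)}) = fd_closure U \<Sigma>"
  obtain a where a: "a \<in> A" "a \<notin> X" "\<forall>(Y, B)\<in>\<Sigma>. a \<in> B \<longrightarrow> (Y, B) = (X, A)"
    using assms[OF XA] by blast
  have "(X, A) \<in> fd_closure U (\<Sigma> - {(X, A)})"
    unfolding eq using XA by (rule fd_closure.base)
  then have "a \<in> X"
    by (rule fd_closure_preserves) (use a in auto)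
  with a(2) show False ..
qed

text \<open>The two fd sets derive each other: the shortened fd is derivable by assumption, and
  reflexivity \<open>X \<rightarrow> Y\<close> followed by \<open>Y \<rightarrow> A\<close> gives
  the original one back.\<close>

lemma not_left_reducedI:
  assumes XA: "(X, A) \<in> \<Sigma>" and Y: "Y \<subset> X" and U: "X \<subseteq> U"
    and YA: "(Y, A) \<in> fd_closure U \<Sigma>"
  shows "\<not> left_reduced U \<Sigma>"
proof -
  let ?\<Sigma>' = "(\<Sigma> - {(X, A)}) \<union> {(Y, A)}"
  have "(X, Y) \<in> fd_closure U ?\<Sigma>'"
    using Y U by (intro fd_closure.R0) auto
  then have "(X, A) \<in> fd_closure U ?\<Sigma>'"
    by (rule fd_closure.R2) (rule fd_closure.base, simp)
  then have "fd_closure U ?\<Sigma>' = fd_closure U \<Sigma>"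
    using YA by (intro equalityI fd_closure_subset) (blast intro: fd_closure.base)+
  then show ?thesis using XA Y unfolding left_reduced_def by blast
qed


section \<open>Tight sets of equations\<close>

definition tight :: "('e, 'v, 'd) eq_structure \<Rightarrow> 'e set \<Rightarrow> bool" where
  "tight S F \<longleftrightarrow> F \<subseteq> eqs S \<and> card F = card (vars_of S F)"

lemma vars_of_Un: "vars_of S (F \<union> G) = vars_of S F \<union> vars_of S G"
  by (auto simp: vars_of_def)

lemma vars_of_mono: "F \<subseteq> G \<Longrightarrow> vars_of S F \<subseteq> vars_of S G"
  by (auto simp: vars_of_def)

lemma vars_of_substructure [simp]: "vars_of (substructure S F) G = vars_of S G"
  by (simp add: vars_of_def substructure_def)

lemma substructure_substructure [simp]: "substructure (substructure S F) G = substructure S G"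
  by (simp add: vars_of_def substructure_def)

lemma eqs_eliminate: "eqs (eliminate S F) = eqs S - F"
  by (simp add: eliminate_def)

lemma vars_of_eliminate: "vars_of (eliminate S F) G = vars_of S G - vars_of S F"
  by (auto simp: vars_of_def eliminate_def)

section \<open>Counting equations and variables in a fixed structure\<close>

context
  fixes S :: "('e, 'v, 'd) eq_structure"
  assumes S: "is_structure S"
begin

lemma finite_eqs: "finite (eqs S)"
  and finite_vars: "finite (vars S)"
  and card_le_vars_of: "F \<subseteq> eqs S \<Longrightarrow> card F \<le> card (vars_of S F)"
  and unique_solution: "F \<subseteq> eqs S \<Longrightarrow> C \<subseteq> vars_of S F \<Longrightarrow>
    card C = card (vars_of S F) - card F \<Longrightarrow>
    \<exists>!\<tau>. \<tau> \<in> extensional (vars_of S F) \<and> (\<forall>x\<in>C. \<tau> x = \<rho> x) \<and> (\<forall>f\<in>F. holds S f \<tau>)"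
  and appears_subset: "f \<in> eqs S \<Longrightarrow> appears S f \<subseteq> vars S"
  and holds_cong: "f \<in> eqs S \<Longrightarrow> (\<And>x. x \<in> appears S f \<Longrightarrow> \<sigma> x = \<tau> x) \<Longrightarrow>
    holds S f \<sigma> = holds S f \<tau>"
  using S by (auto simp: is_structure_def equations_over_vars_def)

lemma vars_of_subset: "F \<subseteq> eqs S \<Longrightarrow> vars_of S F \<subseteq> vars S"
  using appears_subset by (auto simp: vars_of_def)

lemma finite_vars_of: "F \<subseteq> eqs S \<Longrightarrow> finite (vars_of S F)"
  using vars_of_subset finite_vars finite_subset by blast

text \<open>Conditions (a) and (b) quantify over all sets of equations and pass to every subset, so
  completeness of a substructure comes down to the count.\<close>

lemma complete_substructure_iff:
  assumes "F \<subseteq> eqs S"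
  shows "complete_structure (substructure S F) \<longleftrightarrow> tight S F"
proof
  assume "complete_structure (substructure S F)"
  then show "tight S F"
    using assms by (simp add: complete_structure_def tight_def substructure_def)
next
  assume t: "tight S F"
  have "equations_over_vars (substructure S F)"
    using assms S
    by (fastforce simp: is_structure_def equations_over_vars_def substructure_def vars_of_def)
  moreover have "finite (eqs (substructure S F))" "finite (vars (substructure S F))"
    "card (eqs (substructure S F)) = card (vars (substructure S F))"
    using t finite_vars_of[OF assms] finite_subset[OF assms finite_eqs]
    by (auto simp: substructure_def tight_def)
  moreover have "card G \<le> card (vars_of (substructure S F) G)" if "G \<subseteq> eqs (substructure S F)" for G
    using card_le_vars_of[of G] that assms by (auto simp: substructure_def vars_of_def)
  moreover have "\<exists>!\<tau>. \<tau> \<in> extensional (vars_of (substructure S F) G) \<and> (\<forall>x\<in>C. \<tau> x = \<rho> x) \<and>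
      (\<forall>f\<in>G. holds (substructure S F) f \<tau>)"
    if "G \<subseteq> eqs (substructure S F)" "C \<subseteq> vars_of (substructure S F) G"
      "card C = card (vars_of (substructure S F) G) - card G" for G C \<rho>
  proof -
    have "G \<subseteq> eqs S" using that(1) assms by (auto simp: substructure_def)
    moreover have "holds (substructure S F) = holds S" by (simp add: substructure_def)
    ultimately show ?thesis using unique_solution[of G C \<rho>] that(2,3) by simp
  qed
  ultimately show "complete_structure (substructure S F)"
    unfolding complete_structure_def is_structure_def by simp
qed

text \<open>Inclusion-exclusion for equations and for variables, combined with condition (a) for the
  union and the intersection, squeezes all the inequalities into equalities. The last claim is the
  equality case of \<open>vars_of S (F \<inter> G) \<subseteq> vars_of S F \<inter> vars_of S
  G\<close>.\<close>

lemma
  assumes F: "tight S F" and G: "tight S G"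
  shows tight_Un: "tight S (F \<union> G)"
    and tight_Int: "tight S (F \<inter> G)"
    and vars_of_Int: "vars_of S (F \<inter> G) = vars_of S F \<inter> vars_of S G"
proof -
  let ?v = "vars_of S"
  have sub: "F \<subseteq> eqs S" "G \<subseteq> eqs S" using F G by (auto simp: tight_def)
  note fin = finite_vars_of[OF sub(1)] finite_vars_of[OF sub(2)]
    finite_subset[OF sub(1) finite_eqs] finite_subset[OF sub(2) finite_eqs]
  have v: "card (?v F) + card (?v G) = card (?v (F \<union> G)) + card (?v F \<inter> ?v G)"
    unfolding vars_of_Un using fin by (intro card_Un_Int)
  have e: "card F + card G = card (F \<union> G) + card (F \<inter> G)"
    using fin by (intro card_Un_Int)
  have 1: "card (F \<union> G) \<le> card (?v (F \<union> G))" "card (F \<inter> G) \<le> card (?v (F \<inter> G))"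
    using sub by (auto intro!: card_le_vars_of)
  have s: "?v (F \<inter> G) \<subseteq> ?v F \<inter> ?v G" by (auto simp: vars_of_def)
  then have 2: "card (?v (F \<inter> G)) \<le> card (?v F \<inter> ?v G)" using fin by (intro card_mono) auto
  show "tight S (F \<union> G)" "tight S (F \<inter> G)"
    using F G v e 1 2 by (auto simp: tight_def)
  show "?v (F \<inter> G) = ?v F \<inter> ?v G"
    using s F G v e 1 2 fin by (intro card_subset_eq) (auto simp: tight_def)
qed

lemma tight_Union:
  assumes "finite M" "\<And>F. F \<in> M \<Longrightarrow> tight S F"
  shows "tight S (\<Union>M)"
  using assms by (induction M rule: finite_induct) (auto simp: tight_Un, simp add: tight_def vars_of_def)

text \<open>Turns minimality of substructures into pure counting: minimal structures are the
  inclusion-minimal nonempty tight sets.\<close>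

lemma minimal_subs_iff:
  "F \<in> minimal_subs S \<longleftrightarrow> tight S F \<and> F \<noteq> {} \<and> (\<forall>G. G \<noteq> {} \<and> G \<subset> F \<longrightarrow> \<not> tight S G)"
proof (cases "F \<subseteq> eqs S")
  case True
  have "eqs (substructure S F) = F" by (simp add: substructure_def)
  moreover have "complete_structure (substructure S G) \<longleftrightarrow> tight S G" if "G \<subset> F" for G
    using complete_substructure_iff that True by blast
  ultimately show ?thesis
    using True complete_substructure_iff[OF True]
    unfolding minimal_subs_def minimal_structure_def by auto
qed (auto simp: minimal_subs_def tight_def)

lemma finite_minimal_subs: "finite (minimal_subs S)"
  using finite_eqs by (auto simp: minimal_subs_def)

text \<open>The intersection is tight and a proper subset of at least one of the two, so minimality
  makes it empty. For tight sets, disjoint equations mean disjoint variables.\<close>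

lemma minimal_subs_disjoint:
  assumes "F \<in> minimal_subs S" "G \<in> minimal_subs S" "F \<noteq> G"
  shows "vars_of S F \<inter> vars_of S G = {}"
proof -
  have t: "tight S F" "tight S G" using assms minimal_subs_iff by auto
  have "F \<inter> G = {}"
  proof (rule ccontr)
    assume "F \<inter> G \<noteq> {}"
    moreover have "F \<inter> G \<subset> F \<or> F \<inter> G \<subset> G" using assms(3) by blast
    ultimately show False
      using tight_Int[OF t] minimal_subs_iff[THEN iffD1, OF assms(1)]
        minimal_subs_iff[THEN iffD1, OF assms(2)] by metis
  qed
  then show ?thesis using vars_of_Int[OF t] by (simp add: vars_of_def)
qed

lemma tight_Union_minimal_subs: "tight S (\<Union>(minimal_subs S))"
  using tight_Union finite_minimal_subs minimal_subs_iff by blast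

end

text \<open>Condition (a) for the whole set leaves no room for a variable that appears in no
  equation.\<close>

lemma complete_tight:
  assumes "complete_structure S"
  shows "tight S (eqs S)"
proof -
  have S: "is_structure S" and c: "card (eqs S) = card (vars S)"
    using assms by (auto simp: complete_structure_def)
  have "card (vars_of S (eqs S)) \<le> card (vars S)"
    using vars_of_subset[OF S] finite_vars[OF S] by (intro card_mono) auto
  then show ?thesis
    using card_le_vars_of[OF S, of "eqs S"] c by (simp add: tight_def)
qed

text \<open>Take an inclusion-minimal member of the finite family of nonempty tight sets, which
  contains \<open>eqs S\<close>. This is what makes the recursion progress.\<close>

lemma minimal_subs_nonempty:
  assumes "complete_structure S" "eqs S \<noteq> {}"
  shows "minimal_subs S \<noteq> {}"
proof -
  have S: "is_structure S" using assms by (auto simp: complete_structure_def)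
  let ?T = "{F. tight S F \<and> F \<noteq> {}}"
  have "?T \<subseteq> Pow (eqs S)" by (auto simp: tight_def)
  then have "finite ?T" using finite_eqs[OF S] finite_subset by blast
  moreover have "eqs S \<in> ?T" using complete_tight assms by auto
  ultimately obtain F where "F \<in> ?T" "\<And>G. G \<in> ?T \<Longrightarrow> G \<subseteq> F \<Longrightarrow> F = G"
    using finite_has_minimal[of ?T] by blast
  then have "F \<in> minimal_subs S" unfolding minimal_subs_iff[OF S] by blast
  then show ?thesis by blast
qed


section \<open>Elimination of a tight set\<close>

text \<open>Eliminating \<open>F\<close> substitutes its unique solution. Since \<open>F\<close> has
  as many equations as variables, \<open>G\<close> has the same surplus of variables after
  elimination as \<open>F \<union> G\<close> had before, so conditions (a) and (b) for
  \<open>G\<close> follow from those for \<open>F \<union> G\<close>.\<close>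

lemma complete_eliminate:
  fixes S :: "('e, 'v, 'd) eq_structure"
  assumes cS: "complete_structure S" and t: "tight S F"
  shows "complete_structure (eliminate S F)"
proof -
  have S: "is_structure S" and c: "card (eqs S) = card (vars S)"
    using cS by (auto simp: complete_structure_def)
  let ?W = "vars_of S F" and ?S' = "eliminate S F"
  have F: "F \<subseteq> eqs S" and cF: "card F = card ?W" using t by (auto simp: tight_def)
  have finF: "finite F" using F finite_eqs[OF S] finite_subset by blast
  have finW: "finite ?W" using finite_vars_of[OF S F] .
  have W: "?W \<subseteq> vars S" using vars_of_subset[OF S F] .
  have app: "appears S f \<subseteq> vars_of S G" if "f \<in> G" for f G using that by (auto simp: vars_of_def)
  have vars_Un: "card (vars_of S (F \<union> G)) = card F + card (vars_of S G - ?W)" if "G \<subseteq> eqs S" for G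
  proof -
    have "vars_of S (F \<union> G) = ?W \<union> (vars_of S G - ?W)" by (auto simp: vars_of_Un)
    then show ?thesis
      using card_Un_disjoint[of ?W "vars_of S G - ?W"] finW finite_vars_of[OF S that] cF by auto
  qed
  have cardUn: "card (F \<union> G) = card F + card G" if "G \<subseteq> eqs S - F" for G
    using that finF finite_subset[OF _ finite_eqs[OF S], of G] by (intro card_Un_disjoint) auto
  have le: "card G \<le> card (vars_of S G - ?W)" if "G \<subseteq> eqs S - F" for G
    using card_le_vars_of[OF S, of "F \<union> G"] cardUn[OF that] vars_Un[of G] that F by auto

  \<comment> \<open>By tightness no value may be chosen, so condition (b) applies with
    \<open>C = {}\<close>; \<open>undefined\<close> only fills the place of the chosen
    values.\<close>
  have "\<exists>!s. s \<in> extensional ?W \<and> (\<forall>x\<in>{}. s x = undefined x) \<and> (\<forall>f\<in>F. holds S f s)"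
    using cF F by (intro unique_solution[OF S]) auto
  then obtain s where s: "\<And>f. f \<in> F \<Longrightarrow> holds S f s"
    and s_unique: "\<And>\<tau>. \<tau> \<in> extensional ?W \<Longrightarrow> \<forall>f\<in>F. holds S f \<tau> \<Longrightarrow> \<tau> = s"
    by auto
  \<comment> \<open>Uniqueness holds among extensional assignments, hence the detour through
    \<open>restrict\<close>.\<close>
  have solW: "\<tau> x = s x" if "\<forall>f\<in>F. holds S f \<tau>" "x \<in> ?W" for \<tau> x
  proof -
    have "holds S f (restrict \<tau> ?W)" if "f \<in> F" for f
    proof -
      have "\<tau> x = restrict \<tau> ?W x" if "x \<in> appears S f" for x
        using app[OF \<open>f \<in> F\<close>] that by auto
      then show ?thesis
        using holds_cong[OF S, of f \<tau> "restrict \<tau> ?W"] F \<open>f \<in> F\<close> \<open>\<forall>f\<in>F. holds S f \<tau>\<close> by blast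
    qed
    then have "restrict \<tau> ?W = s" by (intro s_unique) auto
    then show ?thesis using that(2) by (metis restrict_apply')
  qed
  define m where "m \<sigma> = (\<lambda>x. if x \<in> ?W then s x else \<sigma> x)" for \<sigma> :: "'v \<Rightarrow> 'd"
  have m_sol: "holds S f (m \<sigma>)" if "f \<in> F" for f \<sigma>
  proof -
    have "s x = m \<sigma> x" if "x \<in> appears S f" for x
      using app[OF \<open>f \<in> F\<close>] that by (auto simp: m_def)
    then show ?thesis
      using holds_cong[OF S, of f s "m \<sigma>"] s F \<open>f \<in> F\<close> by blast
  qed
  \<comment> \<open>The existential assignment in \<open>eliminate\<close> is forced: off
    \<open>?W\<close> it equals \<open>\<sigma>\<close> and on \<open>?W\<close> it equals
    \<open>s\<close>. Elimination is thus substitution by \<open>m\<close>.\<close>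
  have holds': "holds ?S' f \<sigma> \<longleftrightarrow> holds S f (m \<sigma>)" for f \<sigma>
  proof
    assume "holds ?S' f \<sigma>"
    then obtain \<tau> where \<tau>: "\<forall>x. x \<notin> ?W \<longrightarrow> \<tau> x = \<sigma> x" "\<forall>g\<in>F. holds S g \<tau>" "holds S f \<tau>"
      by (auto simp: eliminate_def)
    have "\<tau> = m \<sigma>" using \<tau>(1) solW[OF \<tau>(2)] by (auto simp: m_def)
    then show "holds S f (m \<sigma>)" using \<tau>(3) by simp
  next
    assume "holds S f (m \<sigma>)"
    moreover have "\<forall>x. x \<notin> ?W \<longrightarrow> m \<sigma> x = \<sigma> x" by (simp add: m_def)
    ultimately show "holds ?S' f \<sigma>" using m_sol by (auto simp: eliminate_def)
  qed

  have "equations_over_vars ?S'"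
    unfolding equations_over_vars_def
  proof (intro ballI conjI allI impI)
    fix f assume f: "f \<in> eqs ?S'"
    then have fS: "f \<in> eqs S" by (simp add: eliminate_def)
    show "appears ?S' f \<subseteq> vars ?S'"
      using appears_subset[OF S fS] by (auto simp: eliminate_def)
    fix \<sigma> \<tau> :: "'v \<Rightarrow> 'd"
    assume "\<forall>x\<in>appears ?S' f. \<sigma> x = \<tau> x"
    then have "m \<sigma> x = m \<tau> x" if "x \<in> appears S f" for x
      using that by (auto simp: m_def eliminate_def)
    then show "holds ?S' f \<sigma> = holds ?S' f \<tau>"
      unfolding holds' using holds_cong[OF S fS] by blast
  qed
  moreover have "card (eqs ?S') = card (vars ?S')"
    using card_Diff_subset[OF finF F] card_Diff_subset[OF finW W] c cF
    by (simp add: eliminate_def)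
  moreover have "finite (eqs ?S')" "finite (vars ?S')"
    using finite_eqs[OF S] finite_vars[OF S] by (auto simp: eliminate_def)
  moreover have "card G \<le> card (vars_of ?S' G)" if "G \<subseteq> eqs ?S'" for G
    using le[of G] that by (simp add: vars_of_eliminate eqs_eliminate)
  moreover have "\<exists>!\<tau>. \<tau> \<in> extensional (vars_of ?S' G) \<and> (\<forall>x\<in>C. \<tau> x = \<rho> x) \<and>
      (\<forall>f\<in>G. holds ?S' f \<tau>)"
    if "G \<subseteq> eqs ?S'" and C: "C \<subseteq> vars_of ?S' G" and cC: "card C = card (vars_of ?S' G) - card G"
    for G C \<rho>
  proof -
    let ?V = "vars_of S (F \<union> G)" and ?V' = "vars_of S G - ?W"
    have G: "G \<subseteq> eqs S - F" using that(1) by (simp add: eliminate_def)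
    have V: "?V = ?W \<union> ?V'" by (auto simp: vars_of_Un)
    have C': "C \<subseteq> ?V'" using C by (simp add: vars_of_eliminate)
    \<comment> \<open>Both terms grow by \<open>card F\<close>, so \<open>C\<close> has the right
      size for condition (b) of \<open>F \<union> G\<close>.\<close>
    have "card C = card ?V - card (F \<union> G)"
      using cC vars_Un[OF subset_trans[OF G Diff_subset]] cardUn[OF G]
      by (simp add: vars_of_eliminate)
    then have "\<exists>!\<tau>. \<tau> \<in> extensional ?V \<and> (\<forall>x\<in>C. \<tau> x = \<rho> x) \<and> (\<forall>f\<in>F \<union> G. holds S f \<tau>)"
      using F G C' V by (intro unique_solution[OF S]) auto
    then obtain \<tau>0 where \<tau>0:
        "\<tau>0 \<in> extensional ?V \<and> (\<forall>x\<in>C. \<tau>0 x = \<rho> x) \<and> (\<forall>f\<in>F \<union> G. holds S f \<tau>0)"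
      and unique: "\<forall>\<tau>. \<tau> \<in> extensional ?V \<and> (\<forall>x\<in>C. \<tau> x = \<rho> x) \<and>
        (\<forall>f\<in>F \<union> G. holds S f \<tau>) \<longrightarrow> \<tau> = \<tau>0"
      by (rule ex1E)
    have \<tau>0W: "\<tau>0 x = s x" if "x \<in> ?W" for x using solW[of \<tau>0 x] \<tau>0 that by blast
    \<comment> \<open>The solution \<open>\<tau>0\<close> of \<open>F \<union> G\<close> agrees with
      \<open>s\<close> on \<open>?W\<close>, so \<open>m\<close> recovers it on \<open>?V\<close>
      from its restriction to \<open>?V'\<close>.\<close>
    show ?thesis
      unfolding vars_of_eliminate holds'
    proof (rule ex1I[of _ "restrict \<tau>0 ?V'"], intro conjI)
      show "\<forall>x\<in>C. restrict \<tau>0 ?V' x = \<rho> x" using \<tau>0 C' by auto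
      show "\<forall>f\<in>G. holds S f (m (restrict \<tau>0 ?V'))"
      proof
        fix f assume f: "f \<in> G"
        have "\<tau>0 x = m (restrict \<tau>0 ?V') x" if "x \<in> appears S f" for x
          using \<tau>0W app[OF f] that by (auto simp: m_def)
        moreover have "holds S f \<tau>0" using \<tau>0 f by blast
        ultimately show "holds S f (m (restrict \<tau>0 ?V'))"
          using holds_cong[OF S, of f \<tau>0 "m (restrict \<tau>0 ?V')"] f G by blast
      qed
    next
      fix \<tau> assume \<tau>: "\<tau> \<in> extensional ?V' \<and> (\<forall>x\<in>C. \<tau> x = \<rho> x) \<and> (\<forall>f\<in>G. holds S f (m \<tau>))"
      \<comment> \<open>Conversely, any solution of the reduced system, filled up with
        \<open>s\<close>, solves \<open>F \<union> G\<close> and must coincide with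
        \<open>\<tau>0\<close>.\<close>
      have "holds S f (restrict (m \<tau>) ?V)" if f: "f \<in> F \<union> G" for f
      proof -
        have "holds S f (m \<tau>)" using f m_sol \<tau> by blast
        moreover have "f \<in> eqs S" using f F G by blast
        moreover have "m \<tau> x = restrict (m \<tau>) ?V x" if "x \<in> appears S f" for x
          using app[OF f] that by auto
        ultimately show ?thesis
          using holds_cong[OF S, of f "m \<tau>" "restrict (m \<tau>) ?V"] by blast
      qed
      then have "restrict (m \<tau>) ?V = \<tau>0"
        using \<tau> C' V by (intro unique[rule_format]) (auto simp: m_def subset_iff)
      then have "\<tau> x = \<tau>0 x" if "x \<in> ?V'" for x
        using that V by (metis DiffD2 UnCI m_def restrict_apply')
      then show "\<tau> = restrict \<tau>0 ?V'"
        using \<tau> by (intro extensionalityI[of _ ?V']) auto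
    qed simp
  qed
  ultimately show ?thesis
    unfolding complete_structure_def is_structure_def by simp
qed


section \<open>Total causal mappings\<close>

text \<open>Each round removes at least one minimal structure and leaves a complete structure, so
  induction on the number of equations applies. Statements about all outcomes of the encoding are
  therefore not vacuous.\<close>

lemma coa_t_exists:
  "complete_structure S \<Longrightarrow> \<exists>\<phi>. coa_t S \<phi>"
proof (induction "card (eqs S)" arbitrary: S rule: less_induct)
  case less
  have S: "is_structure S" using less.prems by (simp add: complete_structure_def)
  show ?case
  proof (cases "eqs S = {}")
    case True
    then show ?thesis using coa_t.empty by blast
  next
    case False
    let ?E = "\<Union>(minimal_subs S)"
    have E: "tight S ?E" using tight_Union_minimal_subs[OF S] .
    obtain F where "F \<in> minimal_subs S" "F \<noteq> {}"
      using minimal_subs_nonempty[OF less.prems False] minimal_subs_iff[OF S] by blast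
    then have "eqs S - ?E \<subset> eqs S" using E by (auto simp: tight_def)
    then have "card (eqs (eliminate S ?E)) < card (eqs S)"
      using finite_eqs[OF S] by (simp add: eliminate_def psubset_card_mono)
    then obtain \<psi> where \<psi>: "coa_t (eliminate S ?E) \<psi>"
      using less.hyps complete_eliminate[OF less.prems E] by blast
    have "\<exists>g. bij_betw g F (vars_of S F)" if "F \<in> minimal_subs S" for F
    proof -
      have "tight S F" using that minimal_subs_iff[OF S] by blast
      then have "finite F" "finite (vars_of S F)" "card F = card (vars_of S F)"
        using finite_vars_of[OF S] finite_subset[OF _ finite_eqs[OF S]] by (auto simp: tight_def)
      then show ?thesis by (rule finite_same_card_bij)
    qed
    then have "\<forall>F\<in>minimal_subs S. \<exists>g. bij_betw g F (vars_of S F)" by blast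
    then obtain g where "\<forall>F\<in>minimal_subs S. bij_betw (g F) F (vars_of S F)"
      using bchoice by metis
    then show ?thesis using coa_t.step[OF False _ \<psi>, of g] by blast
  qed
qed

text \<open>Within a round, distinct minimal structures have disjoint variables and each one is
  mapped bijectively. Later rounds see only variables that have not been eliminated, so no variable
  is assigned twice.\<close>

lemma coa_t_mapping:
  assumes "coa_t S \<phi>" "complete_structure S"
  shows "fst ` \<phi> = eqs S \<and> snd ` \<phi> \<subseteq> vars S \<and> inj_on snd \<phi>"
  using assms
proof (induction rule: coa_t.induct)
  case (empty S)
  then show ?case by simp
next
  case (step S g \<psi>)
  let ?M = "minimal_subs S"
  let ?E = "\<Union>?M"
  define \<chi> where "\<chi> = {(f, g F f) | f F. F \<in> ?M \<and> f \<in> F}"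
  have S: "is_structure S" using step.prems by (simp add: complete_structure_def)
  have E: "tight S ?E" using tight_Union_minimal_subs[OF S] .
  have IH: "fst ` \<psi> = eqs S - ?E" "snd ` \<psi> \<subseteq> vars S - vars_of S ?E" "inj_on snd \<psi>"
    using step.IH complete_eliminate[OF step.prems E] by (auto simp: eliminate_def)
  have g: "g F f \<in> vars_of S F" if "F \<in> ?M" "f \<in> F" for F f
    using step.hyps(2)[OF that(1)] that(2) by (auto simp: bij_betw_def)
  have v: "vars_of S F \<subseteq> vars_of S ?E" if "F \<in> ?M" for F
    using that by (intro vars_of_mono) auto
  have \<chi>: "snd ` \<chi> \<subseteq> vars_of S ?E" using g v unfolding \<chi>_def by fastforce
  have "?E \<subseteq> eqs S" using E by (simp add: tight_def)
  moreover have "fst ` \<chi> = ?E"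
  proof
    show "?E \<subseteq> fst ` \<chi>"
    proof
      fix f assume "f \<in> ?E"
      then obtain F where "(f, g F f) \<in> \<chi>" unfolding \<chi>_def by blast
      then show "f \<in> fst ` \<chi>" by (rule image_eqI[rotated]) simp
    qed
  qed (auto simp: \<chi>_def)
  ultimately have "fst ` (\<chi> \<union> \<psi>) = eqs S" using IH(1) unfolding image_Un by auto
  moreover have "snd ` (\<chi> \<union> \<psi>) \<subseteq> vars S"
    using \<chi> IH(2) vars_of_subset[OF S \<open>?E \<subseteq> eqs S\<close>] unfolding image_Un by blast
  moreover have "inj_on snd \<chi>"
  proof (rule inj_onI)
    fix p q assume "p \<in> \<chi>" "q \<in> \<chi>" and eq: "snd p = snd q"
    then obtain f F f' F' where p: "p = (f, g F f)" "F \<in> ?M" "f \<in> F"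
      and q: "q = (f', g F' f')" "F' \<in> ?M" "f' \<in> F'" unfolding \<chi>_def by blast
    have gg: "g F f = g F' f'" using eq p(1) q(1) by simp
    then have "F = F'"
      using minimal_subs_disjoint[OF S p(2) q(2)] g[OF p(2,3)] g[OF q(2,3)] by auto
    moreover have "inj_on (g F) F"
      using step.hyps(2)[OF p(2)] by (simp add: bij_betw_def)
    ultimately have "f = f'"
      using gg p(3) q(3) inj_onD by metis
    with \<open>F = F'\<close> show "p = q" using p q by simp
  qed
  then have "inj_on snd (\<chi> \<union> \<psi>)"
    using IH(2,3) \<chi> unfolding inj_on_Un by blast
  ultimately show ?case unfolding \<chi>_def by (intro conjI)
qed

section \<open>Non-redundancy of the encoding\<close>

lemma h_encode_nonempty: "complete_structure S \<Longrightarrow> h_encode S \<noteq> {}"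
  using coa_t_exists by (auto simp: h_encode_def)

lemma h_encode_non_redundant:
  assumes "complete_structure S" "\<Sigma> \<in> h_encode S"
  shows "non_redundant U \<Sigma>"
proof -
  obtain \<phi> where \<phi>: "coa_t S \<phi>" and \<Sigma>: "\<Sigma> = {encode_fd S f x | f x. (f, x) \<in> \<phi>}"
    using assms(2) by (auto simp: h_encode_def)
  have inj: "inj_on snd \<phi>" using coa_t_mapping[OF \<phi> assms(1)] by blast
  \<comment> \<open>The attribute for \<open>non_redundantI\<close> is \<open>Var x\<close>: it is
    deleted from \<open>Z\<close> in one branch and differs from \<open>Phi\<close> in the
    other.\<close>
  have rhs: "snd (encode_fd S f x) = {Var x}" "Var x \<notin> fst (encode_fd S f x)" for f x
    by (auto simp: encode_fd_def Let_def)
  show ?thesis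
  proof (rule non_redundantI)
    fix X A assume "(X, A) \<in> \<Sigma>"
    then obtain f x where fx: "(f, x) \<in> \<phi>" "(X, A) = encode_fd S f x" using \<Sigma> by blast
    have "(Y, B) = (X, A)" if "(Y, B) \<in> \<Sigma>" "Var x \<in> B" for Y B
    proof -
      obtain f' x' where f'x': "(f', x') \<in> \<phi>" "(Y, B) = encode_fd S f' x'"
        using \<open>(Y, B) \<in> \<Sigma>\<close> \<Sigma> by blast
      \<comment> \<open>A common right-hand side means a common variable, and injectivity of
        \<open>snd\<close> on \<open>\<phi>\<close> then identifies the equations.\<close>
      have "x' = x" using rhs(1)[of f' x'] \<open>Var x \<in> B\<close> by (simp flip: f'x'(2))
      then have "f' = f" using inj_onD[OF inj, of "(f', x')" "(f, x)"] fx(1) f'x'(1) by auto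
      then show ?thesis using fx(2) f'x'(2) \<open>x' = x\<close> by simp
    qed
    moreover have "Var x \<in> A" "Var x \<notin> X" using rhs[where f = f and x = x] by (simp_all flip: fx(2))
    ultimately show "\<exists>a\<in>A. a \<notin> X \<and> (\<forall>(Y, B)\<in>\<Sigma>. a \<in> B \<longrightarrow> (Y, B) = (X, A))" by blast
  qed
qed


section \<open>A structure whose encoding is not canonical\<close>

text \<open>
  Condition (b) rules out a determined single variable occurring in an equation with three
  variables, so the first two equations determine \<open>x\<^sub>0, x\<^sub>1\<close> only jointly. The coefficients of the
  third keep every proper subset of the equations in general position.
\<close>

definition pair_structure :: "(nat, nat, real) eq_structure" where
  "pair_structure =
    \<lparr>eqs = {0, 1, 2}, vars = {0, 1, 2},
     appears = (\<lambda>f. if f = 2 then {0, 1, 2} else {0, 1}),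
     holds = (\<lambda>f \<sigma>. if f = 0 then \<sigma> 0 + \<sigma> 1 = 0 else if f = 1 then \<sigma> 0 = \<sigma> 1
               else \<sigma> 0 + 2 * \<sigma> 1 + \<sigma> 2 = 0)\<rparr>"

section \<open>Completeness of the three-equation structure\<close>

lemma vars_of_pair_structure:
  "vars_of pair_structure F = (if 2 \<in> F then {0, 1, 2} else if F = {} then {} else {0, 1})"
  by (auto simp: vars_of_def pair_structure_def)

lemma subset_012_cases:
  assumes "F \<subseteq> {0, 1, 2 :: nat}"
  obtains "F = {}" | "F = {0}" | "F = {1}" | "F = {2}" | "F = {0, 1}" | "F = {0, 2}"
    | "F = {1, 2}" | "F = {0, 1, 2}"
proof -
  have "F \<in> Pow {0, 1, 2}" using assms by simp
  then have "F = {} \<or> F = {0} \<or> F = {1} \<or> F = {2} \<or> F = {0, 1} \<or> F = {0, 2} \<or>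
      F = {1, 2} \<or> F = {0, 1, 2}"
    unfolding Pow_insert Pow_empty image_Un image_insert image_empty
    by (simp only: Un_insert_left Un_empty_left insert_iff empty_iff) argo
  then show thesis using that by blast
qed

text \<open>Reduces unique solvability to displaying a solution \<open>s\<close> and checking an
  equivalence.\<close>

lemma ex1_extensional:
  assumes "\<And>\<tau>. P \<tau> \<longleftrightarrow> (\<forall>x\<in>V. \<tau> x = s x)"
  shows "\<exists>!\<tau>. \<tau> \<in> extensional V \<and> P \<tau>"
proof (rule ex1I[of _ "restrict s V"])
  fix \<tau> assume "\<tau> \<in> extensional V \<and> P \<tau>"
  then show "\<tau> = restrict s V"
    using assms by (intro extensionalityI[of _ V]) auto
qed (use assms in auto)

text \<open>For every \<open>F\<close> and every admissible \<open>C\<close> the linear system is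
  solved explicitly. Other candidates for \<open>C\<close> have the wrong size or contain a variable
  that does not appear in \<open>F\<close>.\<close>

lemma pair_structure_unique_solution:
  assumes "F \<subseteq> {0, 1, 2}" "C \<subseteq> vars_of pair_structure F"
    "card C = card (vars_of pair_structure F) - card F"
  shows "\<exists>!\<tau>. \<tau> \<in> extensional (vars_of pair_structure F) \<and> (\<forall>x\<in>C. \<tau> x = \<rho> x) \<and>
    (\<forall>f\<in>F. holds pair_structure f \<tau>)"
proof -
  have C: "C \<subseteq> {0, 1, 2}"
    using assms(2) by (auto simp: vars_of_pair_structure split: if_splits)
  note [simp] = vars_of_pair_structure
  have h: "holds pair_structure 0 \<sigma> = (\<sigma> 0 + \<sigma> 1 = 0)"
    "holds pair_structure (Suc 0) \<sigma> = (\<sigma> 0 = \<sigma> 1)"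
    "holds pair_structure 2 \<sigma> = (\<sigma> 0 + 2 * \<sigma> 1 + \<sigma> 2 = 0)" for \<sigma>
    by (simp_all add: pair_structure_def)
  \<comment> \<open>Here \<open>a\<close>, \<open>b\<close>, \<open>c\<close> are the values of the
    variables 0, 1, 2. If equation 2 is not in \<open>F\<close>, variable 2 does not appear and the
    calls pass 0 as a filler for \<open>c\<close>.\<close>
  have sol: ?thesis if "\<And>\<tau>. (\<forall>x\<in>C. \<tau> x = \<rho> x) \<and> (\<forall>f\<in>F. holds pair_structure f \<tau>) \<longleftrightarrow>
      (if 2 \<in> F then \<tau> 0 = a \<and> \<tau> 1 = b \<and> \<tau> 2 = c else F \<noteq> {} \<longrightarrow> \<tau> 0 = a \<and> \<tau> 1 = b)" for a b c
    by (rule ex1_extensional[of _ _ "(\<lambda>_. c)(0 := a, 1 := b)"]) (simp add: that)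
  show ?thesis
    using assms(1)
  proof (cases rule: subset_012_cases)
    case 1
    then show ?thesis using assms(2,3) by auto
  next
    case 2
    from C show ?thesis
    proof (cases rule: subset_012_cases)
      case 2
      show ?thesis
        by (rule sol[of "\<rho> 0" "- \<rho> 0" "0"])
          (auto simp: \<open>F = {0}\<close> \<open>C = {0}\<close> h)
    next
      case 3
      show ?thesis
        by (rule sol[of "- \<rho> 1" "\<rho> 1" "0"])
          (auto simp: \<open>F = {0}\<close> \<open>C = {1}\<close> h)
    qed (use assms(2,3) \<open>F = {0}\<close> in auto)
  next
    case 3
    from C show ?thesis
    proof (cases rule: subset_012_cases)
      case 2
      show ?thesis
        by (rule sol[of "\<rho> 0" "\<rho> 0" "0"])
          (auto simp: \<open>F = {1}\<close> \<open>C = {0}\<close> h)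
    next
      case 3
      show ?thesis
        by (rule sol[of "\<rho> 1" "\<rho> 1" "0"])
          (auto simp: \<open>F = {1}\<close> \<open>C = {1}\<close> h)
    qed (use assms(2,3) \<open>F = {1}\<close> in auto)
  next
    case 4
    from C show ?thesis
    proof (cases rule: subset_012_cases)
      case 5
      show ?thesis
        by (rule sol[of "\<rho> 0" "\<rho> 1" "- \<rho> 0 - 2 * \<rho> 1"])
          (auto simp: \<open>F = {2}\<close> \<open>C = {0, 1}\<close> h)
    next
      case 6
      show ?thesis
        by (rule sol[of "\<rho> 0" "- (\<rho> 0 + \<rho> 2) / 2" "\<rho> 2"])
          (auto simp: \<open>F = {2}\<close> \<open>C = {0, 2}\<close> h)
    next
      case 7
      show ?thesis
        by (rule sol[of "- 2 * \<rho> 1 - \<rho> 2" "\<rho> 1" "\<rho> 2"])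
          (auto simp: \<open>F = {2}\<close> \<open>C = {1, 2}\<close> h)
    qed (use assms(2,3) \<open>F = {2}\<close> in auto)
  next
    case 5
    \<comment> \<open>Finiteness of \<open>C\<close> matters, since an infinite set also has
      cardinality 0.\<close>
    then have "C = {}" using assms(2,3) finite_subset[OF C] by simp
    show ?thesis
      by (rule sol[of 0 0 0]) (auto simp: \<open>F = {0, 1}\<close> \<open>C = {}\<close> h)
  next
    case 6
    from C show ?thesis
    proof (cases rule: subset_012_cases)
      case 2
      show ?thesis
        by (rule sol[of "\<rho> 0" "- \<rho> 0" "\<rho> 0"])
          (auto simp: \<open>F = {0, 2}\<close> \<open>C = {0}\<close> h)
    next
      case 3
      show ?thesis
        by (rule sol[of "- \<rho> 1" "\<rho> 1" "- \<rho> 1"])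
          (auto simp: \<open>F = {0, 2}\<close> \<open>C = {1}\<close> h)
    next
      case 4
      show ?thesis
        by (rule sol[of "\<rho> 2" "- \<rho> 2" "\<rho> 2"])
          (auto simp: \<open>F = {0, 2}\<close> \<open>C = {2}\<close> h)
    qed (use assms(2,3) \<open>F = {0, 2}\<close> in auto)
  next
    case 7
    from C show ?thesis
    proof (cases rule: subset_012_cases)
      case 2
      show ?thesis
        by (rule sol[of "\<rho> 0" "\<rho> 0" "- 3 * \<rho> 0"])
          (auto simp: \<open>F = {1, 2}\<close> \<open>C = {0}\<close> h)
    next
      case 3
      show ?thesis
        by (rule sol[of "\<rho> 1" "\<rho> 1" "- 3 * \<rho> 1"])
          (auto simp: \<open>F = {1, 2}\<close> \<open>C = {1}\<close> h)
    next
      case 4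
      show ?thesis
        by (rule sol[of "- \<rho> 2 / 3" "- \<rho> 2 / 3" "\<rho> 2"])
          (auto simp: \<open>F = {1, 2}\<close> \<open>C = {2}\<close> h)
    qed (use assms(2,3) \<open>F = {1, 2}\<close> in auto)
  next
    case 8
    then have "C = {}" using assms(2,3) finite_subset[OF C] by simp
    show ?thesis
      by (rule sol[of 0 0 0]) (auto simp: \<open>F = {0, 1, 2}\<close> \<open>C = {}\<close> h)
  qed
qed

lemma complete_pair_structure: "complete_structure pair_structure"
proof -
  have "card F \<le> card (vars_of pair_structure F)" if "F \<subseteq> {0, 1, 2}" for F
    using that by (cases rule: subset_012_cases) (simp_all add: vars_of_pair_structure)
  moreover have "eqs pair_structure = {0, 1, 2}" "vars pair_structure = {0, 1, 2}"
    by (simp_all add: pair_structure_def)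
  moreover have "equations_over_vars pair_structure"
    by (auto simp: equations_over_vars_def pair_structure_def)
  ultimately show ?thesis
    using pair_structure_unique_solution
    by (auto simp: complete_structure_def is_structure_def)
qed

text \<open>By counting, the only tight sets are the empty set, \<open>{0, 1}\<close> and the whole
  set.\<close>

lemma minimal_subs_pair_structure: "minimal_subs pair_structure = {{0, 1}}"
proof -
  have S: "is_structure pair_structure"
    using complete_pair_structure by (simp add: complete_structure_def)
  have e: "eqs pair_structure = {0, 1, 2}" by (simp add: pair_structure_def)
  have t: "tight pair_structure F \<longleftrightarrow> F = {} \<or> F = {0, 1} \<or> F = {0, 1, 2}" for F
  proof
    assume "tight pair_structure F"
    then have F: "F \<subseteq> {0, 1, 2}" "card F = card (vars_of pair_structure F)"
      by (auto simp: tight_def e)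
    from F(1) show "F = {} \<or> F = {0, 1} \<or> F = {0, 1, 2}"
      by (cases rule: subset_012_cases) (use F(2) in \<open>simp_all add: vars_of_pair_structure\<close>)
  qed (elim disjE, simp_all add: tight_def e vars_of_pair_structure)
  have t01: "tight pair_structure {0, 1}" by (simp add: t)
  have "F \<in> minimal_subs pair_structure \<longleftrightarrow> F = {0, 1}" for F
  proof
    assume "F \<in> minimal_subs pair_structure"
    note F = minimal_subs_iff[OF S, THEN iffD1, OF this]
    have "\<not> {0, 1} \<subset> F" using F t01 by (metis insert_not_empty)
    moreover have "F = {0, 1} \<or> F = {0, 1, 2}" using F t by metis
    ultimately show "F = {0, 1}" by auto
  next
    assume F: "F = {0, 1}"
    have "\<not> tight pair_structure G" if "G \<noteq> {}" "G \<subset> F" for G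
    proof
      assume "tight pair_structure G"
      then have "G = {0, 1} \<or> G = {0, 1, 2}" using t that(1) by metis
      then show False using that(2) F by (elim disjE) auto
    qed
    then show "F \<in> minimal_subs pair_structure"
      using F t01 minimal_subs_iff[OF S, of F] by simp
  qed
  then show ?thesis by (intro set_eqI) simp
qed

lemma h_encode_pair_structure:
  assumes "\<Sigma> \<in> h_encode pair_structure"
  shows "\<Sigma> = {({Var 0, Upsilon}, {Var 1}), ({Var 1, Upsilon}, {Var 0}),
    ({Var 0, Var 1, Upsilon}, {Var 2})}"
proof -
  let ?S = pair_structure
  obtain \<phi> where "coa_t ?S \<phi>" and \<Sigma>: "\<Sigma> = {encode_fd ?S f x | f x. (f, x) \<in> \<phi>}"
    using assms by (auto simp: h_encode_def)
  from this(1) obtain g :: "nat \<Rightarrow> nat" and \<psi> where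
    g: "bij_betw g {0, 1} {0, 1}" and \<psi>: "coa_t (eliminate ?S {0, 1}) \<psi>"
    and \<phi>: "\<phi> = {(0, g 0), (1, g 1)} \<union> \<psi>"
  proof cases
    case empty
    then show ?thesis by (simp add: pair_structure_def)
  next
    case (step g \<psi>)
    have "bij_betw (g {0, 1}) {0, 1} {0, 1}"
      using step(3)[of "{0, 1}"] by (simp add: minimal_subs_pair_structure vars_of_pair_structure)
    moreover have "coa_t (eliminate ?S {0, 1}) \<psi>"
      using step(4) by (simp add: minimal_subs_pair_structure)
    moreover have "\<phi> = {(0, g {0, 1} 0), (1, g {0, 1} 1)} \<union> \<psi>"
      unfolding step(1) minimal_subs_pair_structure by blast
    ultimately show ?thesis by (rule that)
  qed
  have "tight ?S {0, 1}" by (simp add: tight_def vars_of_pair_structure) (simp add: pair_structure_def)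
  \<comment> \<open>Only equation 2 and variable 2 survive the first round, which forces the rest of
    the mapping.\<close>
  then have "fst ` \<psi> = {2}" "snd ` \<psi> \<subseteq> {2}"
    using coa_t_mapping[OF \<psi> complete_eliminate[OF complete_pair_structure]]
    by (auto simp: eliminate_def vars_of_pair_structure) (auto simp: pair_structure_def)
  then have \<psi>: "\<psi> = {(2, 2)}" by force
  have "g 0 \<in> {0, 1}" "g 1 \<in> {0, 1}" "g 0 \<noteq> g 1"
    using g by (auto simp: bij_betw_def)
  then consider "g 0 = 0" "g 1 = 1" | "g 0 = 1" "g 1 = 0" by auto
  then have \<phi>': "\<phi> = {(0, 0), (1, 1), (2, 2)} \<or> \<phi> = {(0, 1), (1, 0), (2, 2)}"
    by cases (auto simp: \<phi> \<psi>)
  \<comment> \<open>The encoding reads the matrix of the original structure, so the eliminated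
    variables 0 and 1 remain on the left of the third fd.\<close>
  have Z: "{y \<in> vars ?S. structure_matrix ?S f y = 1} = (if f = 2 then {0, 1, 2} else {0, 1})" for f
    by (auto simp: structure_matrix_def pair_structure_def)
  have fd: "encode_fd ?S f 0 = ({Var 1, Upsilon}, {Var 0})"
    "encode_fd ?S f 1 = ({Var 0, Upsilon}, {Var 1})" if "f \<noteq> 2" for f
    using that unfolding encode_fd_def Z by auto
  have fd2: "encode_fd ?S 2 2 = ({Var 0, Var 1, Upsilon}, {Var 2})"
    unfolding encode_fd_def Z by auto
  have "\<Sigma> = (\<lambda>(f, x). encode_fd ?S f x) ` \<phi>" unfolding \<Sigma> by force
  with \<phi>' show ?thesis
    by (elim disjE) (auto simp: fd fd2 fd(2)[simplified])
qed

lemma not_left_reduced_pair_structure: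
  "\<not> left_reduced (attributes pair_structure)
     {({Var 0, Upsilon}, {Var 1}), ({Var 1, Upsilon}, {Var 0}),
      ({Var 0, Var 1, Upsilon}, {Var 2})}"
    (is "\<not> left_reduced ?U ?\<Sigma>")
proof (rule not_left_reducedI)
  let ?X = "{Var 0, Var 1, Upsilon} :: nat attr set" and ?A = "{Var 2} :: nat attr set"
  let ?Y = "{Var 0, Upsilon} :: nat attr set"
  show "?Y \<subset> ?X" by auto
  show "(?X, ?A) \<in> ?\<Sigma>" by simp
  show U: "?X \<subseteq> ?U" by (auto simp: attributes_def pair_structure_def)
  have "(?Y \<union> ?Y, {Var 1} \<union> ?Y) \<in> fd_closure ?U ?\<Sigma>"
    using U by (intro fd_closure.R1 fd_closure.base) auto
  moreover have "{Var 1} \<union> ?Y = ?X" by auto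
  ultimately have "(?Y, ?X) \<in> fd_closure ?U ?\<Sigma>" by simp
  then show "(?Y, ?A) \<in> fd_closure ?U ?\<Sigma>"
    by (rule fd_closure.R2) (rule fd_closure.base, simp)
qed

theorem theorem1:
  "(\<forall>S :: ('e, 'v, 'd) eq_structure. complete_structure S \<longrightarrow>
      h_encode S \<noteq> {} \<and> (\<forall>\<Sigma> \<in> h_encode S. non_redundant (attributes S) \<Sigma>)) \<and>
   (\<exists>S :: (nat, nat, real) eq_structure. complete_structure S \<and>
      h_encode S \<noteq> {} \<and> (\<forall>\<Sigma> \<in> h_encode S. \<not> canonical (attributes S) \<Sigma>))"
proof -
  have "\<not> canonical (attributes pair_structure) \<Sigma>" if "\<Sigma> \<in> h_encode pair_structure" for \<Sigma>
    using not_left_reduced_pair_structure h_encode_pair_structure[OF that]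
    by (simp add: canonical_def)
  then have "\<exists>S :: (nat, nat, real) eq_structure. complete_structure S \<and>
      h_encode S \<noteq> {} \<and> (\<forall>\<Sigma> \<in> h_encode S. \<not> canonical (attributes S) \<Sigma>)"
    using h_encode_nonempty[OF complete_pair_structure] complete_pair_structure
    by (intro exI[of _ pair_structure]) simp
  then show ?thesis
    using h_encode_nonempty h_encode_non_redundant by (intro conjI allI impI ballI)
qed

end
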